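(* Every $2\times n$ transportation polytope has monotone diameter $\le n$. Therefore $2\times n$ transportation problems satisfy the monotone Hirsch conjecture: their monotone diameter is at most the Hirsch bound $2+n-1=n+1$.
   Context: A $2\times n$ transportation polytope is given by supplies $a_1,a_2>0$ and demands $b_1,\dots,b_n>0$ with $a_1+a_2=\sum_j b_j$; it is the set of $x\in\mathbb{R}^{2\times n}$ with $x\ge0$, $\sum_j x_{ij}=a_i$ ($i=1,2$) and $x_{1j}+x_{2j}=b_j$ for all $j$. For $m\times n$ transportation polytopes the Hirsch bound is $m+n-1$ (number $mn$ of nonnegativity inequalities minus the dimension $(m-1)(n-1)$). For a polytope $Q$, a linear objective function $c$ (to be minimized) is nondegenerate if no two vertices of $Q$ have the same objective value; each edge of $Q$ is then oriented toward its endpoint of smaller value. A $c$-monotone path is a directed path in this oriented graph from some vertex to the optimal vertex; its length is its number of edges. The $c$-monotone diameter of $Q$ is the maximum, over all starting vertices, of the length of a shortest $c$-monotone path from that vertex. The monotone diameter is the maximum of the $c$-monotone diameters over all nondegenerate linear objectives $c$. *)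

theory Defs
  imports "HOL-Analysis.Analysis" "HOL-Library.Extended_Nat"
begin

definition transportation_polytope :: "real^'m \<Rightarrow> real^'n \<Rightarrow> (real^'n^'m) set" where
  "transportation_polytope a b =
     {x. (\<forall>i j. 0 \<le> x $ i $ j) \<and>
         (\<forall>i. (\<Sum>j\<in>UNIV. x $ i $ j) = a $ i) \<and>
         (\<forall>j. (\<Sum>i\<in>UNIV. x $ i $ j) = b $ j)}"

definition vertices :: "'a::euclidean_space set \<Rightarrow> 'a set" where
  "vertices Q = {v. v extreme_point_of Q}"

definition nondegenerate_objective :: "'a::euclidean_space set \<Rightarrow> ('a \<Rightarrow> real) \<Rightarrow> bool" where
  "nondegenerate_objective Q c \<longleftrightarrow> linear c \<and> inj_on c (vertices Q)"

definition optimal_vertex :: "'a::euclidean_space set \<Rightarrow> ('a \<Rightarrow> real) \<Rightarrow> 'a \<Rightarrow> bool" where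
  "optimal_vertex Q c v \<longleftrightarrow> v \<in> vertices Q \<and> (\<forall>w\<in>vertices Q. c v \<le> c w)"

definition directed_edges :: "'a::euclidean_space set \<Rightarrow> ('a \<Rightarrow> real) \<Rightarrow> ('a \<times> 'a) set" where
  "directed_edges Q c =
     {(u, v). u \<in> vertices Q \<and> v \<in> vertices Q \<and> closed_segment u v edge_of Q \<and> c v < c u}"

text \<open>
  The oriented graph is acyclic, so its directed walks are directed paths; relational powers
  therefore enumerate path lengths.
\<close>

definition monotone_path_lengths :: "'a::euclidean_space set \<Rightarrow> ('a \<Rightarrow> real) \<Rightarrow> 'a \<Rightarrow> nat set" where
  "monotone_path_lengths Q c u =
     {k. \<exists>v. optimal_vertex Q c v \<and> (u, v) \<in> directed_edges Q c ^^ k}"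

text \<open>
  Lengths are taken in \<^typ>\<open>enat\<close>, so that the absence of a monotone path counts as length
  \<open>\<infinity>\<close>, and a finite bound on a diameter includes the existence of such paths. A supremum
  of a nonempty set of extended naturals with a finite upper bound is a maximum.
\<close>

definition monotone_distance :: "'a::euclidean_space set \<Rightarrow> ('a \<Rightarrow> real) \<Rightarrow> 'a \<Rightarrow> enat" where
  "monotone_distance Q c u = (INF k\<in>monotone_path_lengths Q c u. enat k)"

definition objective_monotone_diameter :: "'a::euclidean_space set \<Rightarrow> ('a \<Rightarrow> real) \<Rightarrow> enat" where
  "objective_monotone_diameter Q c = (SUP u\<in>vertices Q. monotone_distance Q c u)"

definition monotone_diameter :: "'a::euclidean_space set \<Rightarrow> enat" where
  "monotone_diameter Q =
     (SUP c\<in>{c. nondegenerate_objective Q c}. objective_monotone_diameter Q c)"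

text \<open>
  The number of nonnegativity inequalities minus the dimension of an
  \<open>m \<times> n\<close> transportation polytope; for \<open>m, n \<ge> 1\<close> it equals \<open>m + n - 1\<close>.
\<close>

definition transportation_hirsch_bound :: "nat \<Rightarrow> nat \<Rightarrow> nat" where
  "transportation_hirsch_bound m n = m * n - (m - 1) * (n - 1)"

lemma transportation_hirsch_bound_eq:
  assumes "1 \<le> m" "1 \<le> n"
  shows "transportation_hirsch_bound m n = m + n - 1"
proof -
  obtain m' n' where "m = Suc m'" "n = Suc n'"
    using assms by (metis One_nat_def Suc_le_D)
  then show ?thesis
    by (simp add: transportation_hirsch_bound_def algebra_simps)
qed

end

theory Submission
  imports Defs
begin

text \<open>
  A point is determined by its first row, which ranges over a hyperplane section of the box
  \<open>0 \<le> y \<le> b\<close>; vertices have at most one coordinate strictly between its bounds, and edges exchange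
  mass between two columns. Order the columns by the cost of moving a unit into the first row.
  The optimum fills a set \<open>L\<close> of cheapest columns, leaves a set \<open>R\<close> of most expensive ones empty, and
  has one critical column \<open>k\<close>. From any vertex, exchange an unfinished column of \<open>L\<close> with an
  unfinished column of \<open>R\<close>, or with \<open>k\<close> if one of the two sets is finished. Each such exchange
  finishes a column of \<open>L \<union> R\<close> for good. The only exception occurs when \<open>k\<close> itself is fractional
  while both sets are unfinished; then one extra exchange may be needed to empty \<open>k\<close>. Hence
  \<open>(n - 1) + 1\<close> steps suffice.
\<close>

section \<open>Coordinates: the polytope through its first row\<close>

locale two_row_transportation =
  fixes a :: "real^2" and b :: "real^'n"
  assumes a_pos: "\<And>i. 0 < a $ i"
    and b_pos: "\<And>j. 0 < b $ j"
    and balance: "a $ 1 + a $ 2 = (\<Sum>j\<in>UNIV. b $ j)"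
begin

abbreviation Q :: "(real^'n^2) set" where
  "Q \<equiv> transportation_polytope a b"

text \<open>The column sums make the second row the complement of the first, and
  \<open>balance\<close> then gives its row sum for free.\<close>

lemma mem_Q_iff:
  "x \<in> Q \<longleftrightarrow> (\<forall>j. 0 \<le> x $ 1 $ j \<and> x $ 1 $ j \<le> b $ j \<and> x $ 2 $ j = b $ j - x $ 1 $ j) \<and>
     (\<Sum>j\<in>UNIV. x $ 1 $ j) = a $ 1" (is "_ \<longleftrightarrow> ?R")
proof
  assume "x \<in> Q"
  then have "0 \<le> x $ 1 $ j" "0 \<le> x $ 2 $ j" "x $ 1 $ j + x $ 2 $ j = b $ j"
    "(\<Sum>j\<in>UNIV. x $ 1 $ j) = a $ 1" for j
    by (auto simp: transportation_polytope_def sum_2)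
  then show ?R
    by (smt (verit))
next
  assume R: ?R
  then have "(\<Sum>j\<in>UNIV. x $ 2 $ j) = a $ 2"
    using balance by (simp add: sum_subtractf)
  with R show "x \<in> Q"
    by (auto simp: transportation_polytope_def sum_2 forall_2)
qed

lemma Q_eqI:
  assumes "x \<in> Q" "y \<in> Q" "\<And>j. x $ 1 $ j = y $ 1 $ j"
  shows "x = y"
  using assms by (simp add: mem_Q_iff vec_eq_iff forall_2)

lemma convex_Q: "convex Q"
  unfolding convex_def
proof safe
  fix x y :: "real^'n^2" and s t :: real
  assume x: "x \<in> Q" and y: "y \<in> Q" and st: "0 \<le> s" "0 \<le> t" "s + t = 1"
  have le: "s * p + t * q \<le> r" if "p \<le> r" "q \<le> r" for p q r
    using convex_bound_le[OF that st] .
  have sb: "s * p + t * p = p" for p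
    using st by (metis distrib_right mult_1)
  have "(\<Sum>j\<in>UNIV. s * x $ 1 $ j + t * y $ 1 $ j) = s * a $ 1 + t * a $ 1"
    using x y by (simp add: mem_Q_iff sum.distrib flip: sum_distrib_left)
  moreover have "s * (r - p) + t * (r - q) = r - (s * p + t * q)" for p q r
    using sb[of r] by (simp add: algebra_simps)
  ultimately show "s *\<^sub>R x + t *\<^sub>R y \<in> Q"
    using x y st le sb by (simp add: mem_Q_iff)
qed

definition fractional :: "real^'n^2 \<Rightarrow> 'n \<Rightarrow> bool" where
  "fractional x j \<longleftrightarrow> 0 < x $ 1 $ j \<and> x $ 1 $ j < b $ j"

lemma not_fractional: "x \<in> Q \<Longrightarrow> \<not> fractional x j \<Longrightarrow> x $ 1 $ j = 0 \<or> x $ 1 $ j = b $ j"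
  unfolding fractional_def mem_Q_iff by (meson linorder_less_linear not_less)

text \<open>A coordinate bound that is attained at an inner point of a segment in \<open>Q\<close>
  must be attained at both ends. This yields the converse half of the vertex criterion and the face
  property of exchanges.\<close>

lemma not_fractional_between:
  assumes "x \<in> Q" "y \<in> Q" "z \<in> Q" "x \<in> open_segment y z" "\<not> fractional x j"
  shows "y $ 1 $ j = x $ 1 $ j \<and> z $ 1 $ j = x $ 1 $ j"
proof -
  obtain t where t: "0 < t" "t < 1" "x = (1 - t) *\<^sub>R y + t *\<^sub>R z"
    using assms(4) by (auto simp: in_segment)
  then have eq: "x $ 1 $ j = (1 - t) * y $ 1 $ j + t * z $ 1 $ j"
    by simp
  have bnd: "0 \<le> y $ 1 $ j" "0 \<le> z $ 1 $ j" "y $ 1 $ j \<le> b $ j" "z $ 1 $ j \<le> b $ j"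
    using assms by (auto simp: mem_Q_iff)
  consider "x $ 1 $ j = 0" | "x $ 1 $ j = b $ j"
    using not_fractional assms by blast
  then show ?thesis
  proof cases
    case 1
    then have "(1 - t) * y $ 1 $ j = 0 \<and> t * z $ 1 $ j = 0"
      using eq bnd t by (metis add_nonneg_eq_0_iff diff_ge_0_iff_ge less_imp_le mult_nonneg_nonneg)
    then show ?thesis
      using 1 t by auto
  next
    case 2
    then have "(1 - t) * (b $ j - y $ 1 $ j) + t * (b $ j - z $ 1 $ j) = 0"
      using eq by (simp add: algebra_simps)
    then have "(1 - t) * (b $ j - y $ 1 $ j) = 0 \<and> t * (b $ j - z $ 1 $ j) = 0"
      using bnd t by (subst (asm) add_nonneg_eq_0_iff) auto
    then show ?thesis
      using 2 t by auto
  qed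
qed

section \<open>Exchanges between two columns, vertices and edges\<close>

text \<open>Moves one unit of column \<open>j\<close> from the second row to the first. Differences
  \<open>shift i - shift j\<close> preserve all row and column sums, and \<open>c (shift j)\<close>
  is the cost by which columns are ordered.\<close>

definition shift :: "'n \<Rightarrow> real^'n^2" where
  "shift j = axis 1 (axis j 1) - axis 2 (axis j 1)"

lemma shift_nth [simp]:
  "shift j $ 1 $ l = (if l = j then 1 else 0)" "shift j $ 2 $ l = (if l = j then - 1 else 0)"
  by (auto simp: shift_def axis_def)

lemma exchange_in_Q:
  assumes "x \<in> Q" "i \<noteq> j"
    and "0 \<le> x $ 1 $ i + t" "x $ 1 $ i + t \<le> b $ i" "0 \<le> x $ 1 $ j - t" "x $ 1 $ j - t \<le> b $ j"
  shows "x + t *\<^sub>R (shift i - shift j) \<in> Q"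
proof -
  have "(\<Sum>l\<in>UNIV. x $ 1 $ l + t * ((if l = i then 1 else 0) - (if l = j then 1 else 0))) = a $ 1"
    using assms(1) by (simp add: mem_Q_iff sum.distrib sum_subtractf flip: sum_distrib_left)
  then show ?thesis
    using assms by (auto simp: mem_Q_iff algebra_simps)
qed

text \<open>Two fractional columns could exchange mass in either direction, which makes
  \<open>x\<close> a midpoint. Conversely, every column at a bound is constant along a segment
  through \<open>x\<close>, and the row sum fixes a single remaining one.\<close>

lemma vertex_iff:
  "x \<in> vertices Q \<longleftrightarrow> x \<in> Q \<and> (\<forall>i j. fractional x i \<longrightarrow> fractional x j \<longrightarrow> i = j)"
proof (intro iffI conjI allI impI)
  assume x: "x \<in> vertices Q"
  then show xQ: "x \<in> Q"
    by (simp add: vertices_def extreme_point_of_def)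
  fix i j
  assume fr: "fractional x i" "fractional x j"
  show "i = j"
  proof (rule ccontr)
    assume ij: "i \<noteq> j"
    \<comment> \<open>The largest amount that can be moved between \<open>i\<close> and
      \<open>j\<close> in both directions.\<close>
    define t where "t = min (min (x $ 1 $ i) (b $ i - x $ 1 $ i)) (min (x $ 1 $ j) (b $ j - x $ 1 $ j))"
    have t: "0 < t" "t \<le> x $ 1 $ i" "t \<le> b $ i - x $ 1 $ i" "t \<le> x $ 1 $ j" "t \<le> b $ j - x $ 1 $ j"
      using fr by (auto simp: t_def fractional_def)
    define w where "w = t *\<^sub>R (shift i - shift j)"
    have "w $ 1 $ i = t"
      using ij by (simp add: w_def)
    then have "(x - w) $ 1 $ i \<noteq> (x + w) $ 1 $ i"
      using t by simp
    then have "x - w \<noteq> x + w"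
      by metis
    moreover have "x - w \<in> Q" "x + w \<in> Q"
      using exchange_in_Q[OF xQ ij, of "- t"] exchange_in_Q[OF xQ ij, of t] t
      by (auto simp: w_def)
    moreover have "x = midpoint (x - w) (x + w)"
      by (simp add: midpoint_def flip: scaleR_2)
    ultimately show False
      using x midpoint_in_open_segment[of "x - w" "x + w"]
      unfolding vertices_def extreme_point_of_def by auto
  qed
next
  assume x: "x \<in> Q \<and> (\<forall>i j. fractional x i \<longrightarrow> fractional x j \<longrightarrow> i = j)"
  have False if y: "y \<in> Q" and z: "z \<in> Q" and seg: "x \<in> open_segment y z" for y z
  proof -
    have nf: "y $ 1 $ j = z $ 1 $ j" if "\<not> fractional x j" for j
      using not_fractional_between[OF _ y z seg that] x by simp
    have "y $ 1 $ j = z $ 1 $ j" for j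
    proof (cases "fractional x j")
      case True
      then have "y $ 1 $ l = z $ 1 $ l" if "l \<noteq> j" for l
        using nf x that by blast
      then have "(\<Sum>l\<in>UNIV - {j}. y $ 1 $ l) = (\<Sum>l\<in>UNIV - {j}. z $ 1 $ l)"
        by (intro sum.cong) auto
      moreover have "(\<Sum>l\<in>UNIV. y $ 1 $ l) = (\<Sum>l\<in>UNIV. z $ 1 $ l)"
        using y z by (simp add: mem_Q_iff)
      ultimately show ?thesis
        by (simp add: sum.remove[of UNIV j])
    qed (use nf in auto)
    then have "y = z"
      using Q_eqI y z by blast
    then show False
      using seg by simp
  qed
  then show "x \<in> vertices Q"
    using x by (auto simp: vertices_def extreme_point_of_def)
qed

text \<open>All columns except \<open>i\<close> and \<open>j\<close> sit at a bound, so fixing them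
  cuts out a face. The row sum leaves this face one degree of freedom, and \<open>t\<close> is the
  largest feasible exchange, so the face ends at \<open>v\<close>.\<close>

lemma exchange_edge:
  assumes x: "x \<in> vertices Q" and ij: "i \<noteq> j"
    and others: "\<And>l. fractional x l \<Longrightarrow> l = i \<or> l = j"
    and pos: "x $ 1 $ i < b $ i" "0 < x $ 1 $ j"
  defines "t \<equiv> min (b $ i - x $ 1 $ i) (x $ 1 $ j)"
  defines "v \<equiv> x + t *\<^sub>R (shift i - shift j)"
  shows "v \<in> vertices Q" "closed_segment x v edge_of Q"
proof -
  have xQ: "x \<in> Q"
    using x by (simp add: vertex_iff)
  have xb: "0 \<le> x $ 1 $ l" "x $ 1 $ l \<le> b $ l" for l
    using xQ by (auto simp: mem_Q_iff)
  have t: "0 < t" "t \<le> b $ i - x $ 1 $ i" "t \<le> x $ 1 $ j" "t = b $ i - x $ 1 $ i \<or> t = x $ 1 $ j"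
    using pos by (auto simp: t_def)
  have vQ: "v \<in> Q"
    unfolding v_def using t xb[of i] xb[of j] by (intro exchange_in_Q[OF xQ ij]) auto
  have v_nth: "v $ 1 $ i = x $ 1 $ i + t" "v $ 1 $ j = x $ 1 $ j - t"
    "\<And>l. l \<noteq> i \<Longrightarrow> l \<noteq> j \<Longrightarrow> v $ 1 $ l = x $ 1 $ l"
    using ij by (auto simp: v_def)
  have v_end: "\<not> fractional v i \<or> \<not> fractional v j"
    using t by (auto simp: fractional_def v_nth)
  have v_frac: "l = i \<or> l = j" if "fractional v l" for l
    using that others[of l] v_nth(3)[of l] unfolding fractional_def by metis
  then show v: "v \<in> vertices Q"
    using vQ v_end unfolding vertex_iff by metis
  \<comment> \<open>At most one of \<open>i\<close>, \<open>j\<close> is fractional, and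
    \<open>pos\<close> excludes the other bounds. Thus no mass can move from \<open>i\<close> back
    to \<open>j\<close>: \<open>x\<close> is the other end of the face.\<close>
  have x_end: "x $ 1 $ i = 0 \<or> x $ 1 $ j = b $ j"
    using x ij not_fractional[OF xQ] pos unfolding vertex_iff by force
  have "v $ 1 $ i \<noteq> x $ 1 $ i"
    using t v_nth by simp
  then have "x \<noteq> v"
    by metis
  have on_segment: "y \<in> closed_segment x v"
    if y: "y \<in> Q" and agree: "\<And>l. l \<noteq> i \<Longrightarrow> l \<noteq> j \<Longrightarrow> y $ 1 $ l = x $ 1 $ l" for y
  proof -
    \<comment> \<open>The amount that \<open>y\<close> has moved from \<open>j\<close> to
      \<open>i\<close>. The bounds on \<open>y\<close>, together with \<open>x_end\<close> and the
      choice of \<open>t\<close>, will give 0 \<le> \<open>s\<close> \<le> \<open>t\<close>.\<close>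
    define s where "s = y $ 1 $ i - x $ 1 $ i"
    have split: "(\<Sum>l\<in>UNIV. z $ 1 $ l) = z $ 1 $ i + z $ 1 $ j + (\<Sum>l\<in>UNIV - {i} - {j}. z $ 1 $ l)"
      for z :: "real^'n^2"
      using ij by (subst sum.remove[of UNIV i], simp, simp, subst sum.remove[of _ j]) auto
    have "(\<Sum>l\<in>UNIV - {i} - {j}. y $ 1 $ l) = (\<Sum>l\<in>UNIV - {i} - {j}. x $ 1 $ l)"
      by (intro sum.cong) (auto simp: agree)
    then have yj: "y $ 1 $ j = x $ 1 $ j - s"
      using split[of x] split[of y] xQ y by (simp add: mem_Q_iff s_def)
    have yb: "0 \<le> y $ 1 $ l" "y $ 1 $ l \<le> b $ l" for l
      using y by (auto simp: mem_Q_iff)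
    have "0 \<le> s" "s \<le> t"
      using x_end t(4) yb[of i] yb[of j] yj by (auto simp: s_def)
    moreover have "y = x + s *\<^sub>R (shift i - shift j)"
    proof (rule Q_eqI[OF y])
      show "x + s *\<^sub>R (shift i - shift j) \<in> Q"
        using yb[of i] yb[of j] yj by (intro exchange_in_Q[OF xQ ij]) (auto simp: s_def)
      show "y $ 1 $ l = (x + s *\<^sub>R (shift i - shift j)) $ 1 $ l" for l
        using agree[of l] yj ij s_def by (cases "l = i"; cases "l = j") simp_all
    qed
    then have "y = (1 - s / t) *\<^sub>R x + (s / t) *\<^sub>R v"
      using t(1) by (simp add: v_def algebra_simps)
    ultimately show ?thesis
      using t(1) unfolding closed_segment_def by (auto intro!: exI[of _ "s / t"])
  qed
  have "closed_segment x v face_of Q"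
    unfolding face_of_def
  proof (intro conjI ballI impI convex_closed_segment)
    show "closed_segment x v \<subseteq> Q"
      using xQ vQ convex_Q by (simp add: closed_segment_subset)
  next
    fix y z w
    assume y: "y \<in> Q" and z: "z \<in> Q" and w: "w \<in> closed_segment x v" and seg: "w \<in> open_segment y z"
    have wQ: "w \<in> Q"
      using w xQ vQ convex_Q closed_segment_subset by blast
    obtain r where r: "w = (1 - r) *\<^sub>R x + r *\<^sub>R v"
      using w by (auto simp: closed_segment_def)
    have w_eq: "w $ 1 $ l = x $ 1 $ l" if "l \<noteq> i" "l \<noteq> j" for l
      using v_nth(3)[OF that] by (simp add: r algebra_simps)
    have "y $ 1 $ l = x $ 1 $ l \<and> z $ 1 $ l = x $ 1 $ l" if "l \<noteq> i" "l \<noteq> j" for l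
    proof -
      have "\<not> fractional w l"
        using others[of l] w_eq[OF that] that by (auto simp: fractional_def)
      then show ?thesis
        using not_fractional_between[OF wQ y z seg] w_eq[OF that] by metis
    qed
    then show "y \<in> closed_segment x v" "z \<in> closed_segment x v"
      using on_segment y z by blast+
  qed
  moreover have "aff_dim (closed_segment x v) = 1"
    using \<open>x \<noteq> v\<close> by (simp add: segment_convex_hull aff_dim_convex_hull)
  ultimately show "closed_segment x v edge_of Q"
    by (simp add: edge_of_def)
qed

text \<open>
  Ties between shift costs are harmless: injectivity of the objective on vertices makes every weak
  improvement strict.
\<close>

lemma exchange:
  assumes c: "nondegenerate_objective Q c"
    and x: "x \<in> vertices Q" and ij: "i \<noteq> j"
    and others: "\<And>l. fractional x l \<Longrightarrow> l = i \<or> l = j"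
    and pos: "x $ 1 $ i < b $ i" "0 < x $ 1 $ j"
    and cost: "c (shift i) \<le> c (shift j)"
  obtains v where "(x, v) \<in> directed_edges Q c"
    "v $ 1 $ i = x $ 1 $ i + min (b $ i - x $ 1 $ i) (x $ 1 $ j)"
    "v $ 1 $ j = x $ 1 $ j - min (b $ i - x $ 1 $ i) (x $ 1 $ j)"
    "\<And>l. l \<noteq> i \<Longrightarrow> l \<noteq> j \<Longrightarrow> v $ 1 $ l = x $ 1 $ l"
proof -
  define t where "t = min (b $ i - x $ 1 $ i) (x $ 1 $ j)"
  define v where "v = x + t *\<^sub>R (shift i - shift j)"
  have t: "0 < t"
    using pos by (simp add: t_def)
  have v: "v \<in> vertices Q" "closed_segment x v edge_of Q"
    using exchange_edge[OF x ij others pos] by (auto simp: v_def t_def)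
  have v_nth: "v $ 1 $ i = x $ 1 $ i + t" "v $ 1 $ j = x $ 1 $ j - t"
    "\<And>l. l \<noteq> i \<Longrightarrow> l \<noteq> j \<Longrightarrow> v $ 1 $ l = x $ 1 $ l"
    using ij by (auto simp: v_def)
  have "linear c"
    using c by (simp add: nondegenerate_objective_def)
  then have "c v = c x + t * (c (shift i) - c (shift j))"
    by (simp add: v_def linear_add linear_diff linear_scale)
  then have "c v \<le> c x"
    using cost t by (simp add: mult_nonneg_nonpos)
  moreover have "v \<noteq> x"
    using v_nth(1) t by auto
  then have "c v \<noteq> c x"
    using c x v(1) by (auto simp: nondegenerate_objective_def dest: inj_onD)
  ultimately have "(x, v) \<in> directed_edges Q c"
    using x v by (simp add: directed_edges_def)
  with that v_nth show ?thesis
    by (simp add: t_def)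
qed

section \<open>The critical column of a cost order\<close>

text \<open>Greedy filling in order of cost: \<open>L\<close> is a largest cheapest-first set whose
  demand stays below \<open>a $ 1\<close>, and \<open>k\<close> is a cheapest column outside it.
  Choosing by cardinality copes with ties without sorting.\<close>

lemma critical_column:
  fixes d :: "'n \<Rightarrow> real"
  obtains L k where "k \<notin> L" "\<And>i. i \<in> L \<Longrightarrow> d i \<le> d k" "\<And>j. j \<notin> L \<Longrightarrow> d k \<le> d j"
    "sum (($) b) L < a $ 1" "a $ 1 \<le> sum (($) b) L + b $ k"
proof -
  define lower where "lower = {S. (\<forall>i\<in>S. \<forall>j. j \<notin> S \<longrightarrow> d i \<le> d j) \<and> sum (($) b) S < a $ 1}"
  have "{} \<in> lower"
    using a_pos by (simp add: lower_def)
  moreover have "finite (card ` lower)"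
    by simp
  ultimately have "Max (card ` lower) \<in> card ` lower"
    by (intro Max_in) auto
  then obtain L where L: "L \<in> lower" "card L = Max (card ` lower)"
    by auto
  have max: "card S \<le> card L" if "S \<in> lower" for S
    using that L by simp
  \<comment> \<open>The total demand exceeds \<open>a $ 1\<close> because the second supply is
    positive.\<close>
  have "L \<noteq> UNIV"
    using L(1) balance a_pos[of 2] by (auto simp: lower_def)
  then obtain k where k: "k \<notin> L" "\<And>j. j \<notin> L \<Longrightarrow> d k \<le> d j"
    using ex_is_arg_min_if_finite[of "- L" d] by (auto simp: is_arg_min_linorder)
  have below: "d i \<le> d k" if "i \<in> L" for i
    using that L(1) k(1) by (auto simp: lower_def)
  \<comment> \<open>The enlarged set is still cheapest-first, so by maximality of \<open>L\<close>
    it can only fail the demand inequality.\<close>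
  have "insert k L \<notin> lower"
    using max[of "insert k L"] k(1) by auto
  moreover have "\<forall>i\<in>insert k L. \<forall>j. j \<notin> insert k L \<longrightarrow> d i \<le> d j"
    using L(1) k by (auto simp: lower_def)
  ultimately have "a $ 1 \<le> sum (($) b) L + b $ k"
    using k(1) by (simp add: lower_def not_less add.commute)
  with that k below L(1) show ?thesis
    by (auto simp: lower_def)
qed

lemma sum_split:
  fixes f :: "'n \<Rightarrow> real"
  assumes "k \<notin> L"
  shows "(\<Sum>j\<in>UNIV. f j) = sum f L + f k + sum f (- insert k L)"
proof -
  have "(UNIV :: 'n set) = insert k L \<union> - insert k L"
    by blast
  then have "(\<Sum>j\<in>UNIV. f j) = sum f (insert k L) + sum f (- insert k L)"
    by (metis Compl_disjoint finite sum.union_disjoint)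
  then show ?thesis
    using assms by simp
qed

section \<open>A potential counting unfinished columns\<close>

definition unfilled :: "'n set \<Rightarrow> real^'n^2 \<Rightarrow> 'n set" where
  "unfilled L x = {i \<in> L. x $ 1 $ i \<noteq> b $ i}"

definition unemptied :: "'n set \<Rightarrow> real^'n^2 \<Rightarrow> 'n set" where
  "unemptied R x = {j \<in> R. x $ 1 $ j \<noteq> 0}"

text \<open>The added unit pays for the one exchange that may empty \<open>k\<close> without
  finishing a column of \<open>L\<close> or of its counterpart.\<close>

definition potential :: "'n set \<Rightarrow> 'n \<Rightarrow> real^'n^2 \<Rightarrow> nat" where
  "potential L k x = card (unfilled L x \<union> unemptied (- insert k L) x) +
     of_bool (fractional x k \<and> unfilled L x \<noteq> {} \<and> unemptied (- insert k L) x \<noteq> {})"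

text \<open>Column \<open>k\<close> is never counted, so the cardinality is at most
  \<open>CARD('n) - 1\<close>, which leaves room for the extra unit.\<close>

lemma potential_le:
  assumes "k \<notin> L"
  shows "potential L k x \<le> CARD('n)"
proof -
  have "card (unfilled L x \<union> unemptied (- insert k L) x) < CARD('n)"
    using assms by (intro psubset_card_mono) (auto simp: unfilled_def unemptied_def)
  then show ?thesis
    by (simp add: potential_def of_bool_def)
qed

section \<open>Descent of the potential for a fixed objective\<close>

context
  fixes c :: "real^'n^2 \<Rightarrow> real" and L :: "'n set" and k :: 'n
  assumes c: "nondegenerate_objective Q c"
    and k: "k \<notin> L"
    and below: "\<And>i. i \<in> L \<Longrightarrow> c (shift i) \<le> c (shift k)"
    and above: "\<And>j. j \<notin> L \<Longrightarrow> c (shift k) \<le> c (shift j)"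
    and crit: "sum (($) b) L < a $ 1" "a $ 1 \<le> sum (($) b) L + b $ k"
begin

abbreviation "UL \<equiv> unfilled L"
abbreviation "UR \<equiv> unemptied (- insert k L)"

text \<open>Finishing a column lowers the cardinality; the last assumption prevents the extra unit
  from appearing anew and offsetting this.\<close>

lemma potential_less:
  assumes "UL v \<subseteq> UL x" "UR v \<subseteq> UR x" "UL v \<union> UR v \<noteq> UL x \<union> UR x"
    and "fractional v k \<Longrightarrow> UL v \<noteq> {} \<Longrightarrow> UR v \<noteq> {} \<Longrightarrow> fractional x k"
  shows "potential L k v < potential L k x"
proof -
  have "card (UL v \<union> UR v) < card (UL x \<union> UR x)"
    using assms by (intro psubset_card_mono) auto
  moreover have "fractional x k \<and> UL x \<noteq> {} \<and> UR x \<noteq> {}"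
    if "fractional v k \<and> UL v \<noteq> {} \<and> UR v \<noteq> {}"
    using that assms by blast
  ultimately show ?thesis
    by (auto simp: potential_def of_bool_def)
qed

text \<open>As \<open>k\<close> is the only fractional column, an unfilled column \<open>i\<close>
  of \<open>L\<close> is empty. Moving mass from \<open>k\<close> to \<open>i\<close> either fills
  \<open>i\<close> or empties \<open>k\<close>.\<close>

lemma progress_critical_fractional:
  assumes x: "x \<in> vertices Q" and ne: "UL x \<noteq> {}" "UR x \<noteq> {}" and fr: "fractional x k"
  shows "\<exists>v. (x, v) \<in> directed_edges Q c \<and> potential L k v < potential L k x"
proof -
  obtain i where i: "i \<in> L" "x $ 1 $ i \<noteq> b $ i"
    using ne by (auto simp: unfilled_def)
  have uniq: "l = k" if "fractional x l" for l
    using x fr that by (auto simp: vertex_iff)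
  have ik: "i \<noteq> k"
    using i k by auto
  have "x \<in> Q"
    using x by (simp add: vertex_iff)
  then have xi: "x $ 1 $ i = 0"
    using not_fractional i ik uniq by blast
  have pos: "x $ 1 $ i < b $ i" "0 < x $ 1 $ k"
    using xi b_pos fr by (auto simp: fractional_def)
  obtain v where v: "(x, v) \<in> directed_edges Q c"
    "v $ 1 $ i = x $ 1 $ i + min (b $ i - x $ 1 $ i) (x $ 1 $ k)"
    "v $ 1 $ k = x $ 1 $ k - min (b $ i - x $ 1 $ i) (x $ 1 $ k)"
    "\<And>l. l \<noteq> i \<Longrightarrow> l \<noteq> k \<Longrightarrow> v $ 1 $ l = x $ 1 $ l"
    using exchange[OF c x ik _ pos below[OF i(1)]] uniq by metis
  have "l \<noteq> i \<and> l \<noteq> k" if "l \<in> - insert k L" for l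
    using that i by auto
  then have sub: "UL v \<subseteq> UL x" "UR v = UR x"
    using v(4) i k by (fastforce simp: unfilled_def, simp add: unemptied_def cong: conj_cong)
  have "potential L k v < potential L k x"
  proof (cases "b $ i \<le> x $ 1 $ k")
    case True
    then have "i \<notin> UL v" "i \<in> UL x" "i \<notin> UR v"
      using v(2) i xi by (auto simp: unfilled_def unemptied_def)
    then show ?thesis
      using sub fr by (intro potential_less) auto
  next
    case False
    \<comment> \<open>No column need be finished here, but \<open>k\<close> is no longer fractional,
      so the extra unit disappears.\<close>
    then have "v $ 1 $ k = 0"
      using v(3) xi by simp
    then have "potential L k v = card (UL v \<union> UR v)"
      by (simp add: potential_def fractional_def)
    also have "\<dots> \<le> card (UL x \<union> UR x)"
      using sub by (intro card_mono) auto
    also have "\<dots> < potential L k x"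
      using fr ne by (simp add: potential_def)
    finally show ?thesis .
  qed
  with v(1) show ?thesis
    by blast
qed

text \<open>Treats the remaining pairs together: \<open>L\<close> with the expensive side, and
  either of them with \<open>k\<close>. When \<open>k\<close> takes part, the inequality in
  \<open>mem\<close> makes the partner the bottleneck, so the exchange finishes the partner.\<close>

lemma progress_exchange:
  assumes x: "x \<in> vertices Q" and ij: "i \<noteq> j"
    and mem: "i \<in> UL x \<or> i = k \<and> x $ 1 $ j \<le> b $ k - x $ 1 $ k \<and> UL x = {}"
      "j \<in> UR x \<or> j = k \<and> b $ i - x $ 1 $ i \<le> x $ 1 $ k \<and> UR x = {}"
    and others: "\<And>l. fractional x l \<Longrightarrow> l = i \<or> l = j"
  shows "\<exists>v. (x, v) \<in> directed_edges Q c \<and> potential L k v < potential L k x"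
proof -
  have xb: "0 \<le> x $ 1 $ l" "x $ 1 $ l \<le> b $ l" for l
    using x by (auto simp: vertex_iff mem_Q_iff)
  have ui: "x $ 1 $ l < b $ l" if "l \<in> UL x" for l
    using that xb[of l] by (auto simp: unfilled_def)
  have uj: "0 < x $ 1 $ l" if "l \<in> UR x" for l
    using that xb[of l] by (auto simp: unemptied_def)
  have pos: "x $ 1 $ i < b $ i" "0 < x $ 1 $ j"
    using mem ij ui[of i] uj[of j] by auto
  \<comment> \<open>The two costs are compared through that of \<open>k\<close>.\<close>
  have cost: "c (shift i) \<le> c (shift j)"
    using mem below[of i] above[of j] by (fastforce simp: unfilled_def unemptied_def)
  obtain v where v: "(x, v) \<in> directed_edges Q c"
    "v $ 1 $ i = x $ 1 $ i + min (b $ i - x $ 1 $ i) (x $ 1 $ j)"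
    "v $ 1 $ j = x $ 1 $ j - min (b $ i - x $ 1 $ i) (x $ 1 $ j)"
    "\<And>l. l \<noteq> i \<Longrightarrow> l \<noteq> j \<Longrightarrow> v $ 1 $ l = x $ 1 $ l"
    using exchange[OF c x ij others pos cost] by metis
  have kU: "k \<notin> UL x" "k \<notin> UR x"
    using k by (auto simp: unfilled_def unemptied_def)
  have iL: "i \<in> L \<or> i = k" and jL: "j \<notin> L"
    using mem k by (auto simp: unfilled_def unemptied_def)
  have sub: "UL v \<subseteq> UL x"
  proof
    fix l assume l: "l \<in> UL v"
    then show "l \<in> UL x"
      using v(4)[of l] pos(1) jL by (cases "l = i"; cases "l = j") (auto simp: unfilled_def)
  qed
  have sub': "UR v \<subseteq> UR x"
  proof
    fix l assume l: "l \<in> UR v"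
    then show "l \<in> UR x"
      using v(4)[of l] pos(2) iL by (cases "l = i"; cases "l = j") (auto simp: unemptied_def)
  qed
  have fin: "(i \<in> UL x \<and> v $ 1 $ i = b $ i) \<or> (j \<in> UR x \<and> v $ 1 $ j = 0)"
    using mem ij v(2,3) by (auto simp: min_def)
  have "i \<notin> UL v \<union> UR v" if "i \<in> UL x" "v $ 1 $ i = b $ i"
    using that by (simp add: unfilled_def unemptied_def)
  moreover have "j \<notin> UL v \<union> UR v" if "v $ 1 $ j = 0"
    using that jL by (simp add: unfilled_def unemptied_def)
  ultimately have "UL v \<union> UR v \<noteq> UL x \<union> UR x"
    using fin by blast
  \<comment> \<open>If \<open>k\<close> took part, one of the two sets would be empty already and
    would stay so; otherwise column \<open>k\<close> is unchanged.\<close>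
  moreover have "fractional x k" if "fractional v k" "UL v \<noteq> {}" "UR v \<noteq> {}"
  proof -
    have "i \<noteq> k" "j \<noteq> k"
      using mem sub sub' that kU by blast+
    then show ?thesis
      using v(4)[of k] that by (simp add: fractional_def)
  qed
  ultimately show ?thesis
    using potential_less sub sub' v(1) by blast
qed

lemma progress:
  assumes x: "x \<in> vertices Q" and ne: "UL x \<union> UR x \<noteq> {}"
  shows "\<exists>v. (x, v) \<in> directed_edges Q c \<and> potential L k v < potential L k x"
proof -
  have xQ: "x \<in> Q"
    using x by (simp add: vertex_iff)
  have xb: "0 \<le> x $ 1 $ l" "x $ 1 $ l \<le> b $ l" for l
    using xQ by (auto simp: mem_Q_iff)
  have total: "sum (($) (x $ 1)) L + x $ 1 $ k + sum (($) (x $ 1)) (- insert k L) = a $ 1"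
    using xQ sum_split[OF k, of "($) (x $ 1)"] by (simp add: mem_Q_iff)
  have frac_mem: "l \<in> UL x \<or> l \<in> UR x \<or> l = k" if "fractional x l" for l
    using that by (auto simp: fractional_def unfilled_def unemptied_def)
  have disj: "l \<notin> UR x" if "l \<in> UL x" for l
    using that by (auto simp: unfilled_def unemptied_def)
  have kU: "k \<notin> UL x" "k \<notin> UR x"
    using k by (auto simp: unfilled_def unemptied_def)
  have uniq: "l = l'" if "fractional x l" "fractional x l'" for l l'
    using x that by (simp add: vertex_iff)
  \<comment> \<open>The fractional column of \<open>UL x\<close> is preferred if there is one, and
    likewise for \<open>j\<close> below; this ensures that no fractional column lies outside the
    exchanged pair.\<close>
  obtain i where i: "UL x \<noteq> {} \<Longrightarrow> i \<in> UL x" "\<And>l. fractional x l \<Longrightarrow> l \<in> UL x \<Longrightarrow> l = i"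
    using uniq by (metis ex_in_conv)
  obtain j where j: "UR x \<noteq> {} \<Longrightarrow> j \<in> UR x" "\<And>l. fractional x l \<Longrightarrow> l \<in> UR x \<Longrightarrow> l = j"
    using uniq by (metis ex_in_conv)
  consider "UL x \<noteq> {}" "UR x \<noteq> {}" "fractional x k" | "UL x \<noteq> {}" "UR x \<noteq> {}" "\<not> fractional x k"
    | "UL x \<noteq> {}" "UR x = {}" | "UL x = {}" "UR x \<noteq> {}"
    using ne by blast
  then show ?thesis
  proof cases
    case 1
    then show ?thesis
      using progress_critical_fractional x by blast
  next
    case 2
    then show ?thesis
      using i j frac_mem disj by (intro progress_exchange[OF x, of i j]) blast+
  next
    case 3
    \<comment> \<open>With the expensive columns empty, the row sum puts into \<open>k\<close> more
      than the whole deficit of \<open>L\<close>, hence enough to fill \<open>i\<close>.\<close>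
    have "sum (($) (x $ 1)) (- insert k L) = 0"
      using 3 by (intro sum.neutral) (auto simp: unemptied_def)
    then have "(\<Sum>l\<in>L. b $ l - x $ 1 $ l) < x $ 1 $ k"
      using total crit by (simp add: sum_subtractf)
    moreover have "b $ i - x $ 1 $ i \<le> (\<Sum>l\<in>L. b $ l - x $ 1 $ l)"
      using i(1) 3 xb by (intro member_le_sum) (auto simp: unfilled_def)
    ultimately have "b $ i - x $ 1 $ i \<le> x $ 1 $ k"
      by simp
    then show ?thesis
      using 3 i frac_mem kU by (intro progress_exchange[OF x, of i k]) blast+
  next
    case 4
    \<comment> \<open>With \<open>L\<close> full, the row sum bounds all mass in the expensive
      columns by the free capacity of \<open>k\<close>, which can therefore absorb column
      \<open>j\<close>.\<close>
    have "sum (($) (x $ 1)) L = sum (($) b) L"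
      using 4 by (intro sum.cong) (auto simp: unfilled_def)
    then have "sum (($) (x $ 1)) (- insert k L) \<le> b $ k - x $ 1 $ k"
      using total crit by simp
    moreover have "x $ 1 $ j \<le> sum (($) (x $ 1)) (- insert k L)"
      using j(1) 4 xb by (intro member_le_sum) (auto simp: unemptied_def)
    ultimately have "x $ 1 $ j \<le> b $ k - x $ 1 $ k"
      by simp
    then show ?thesis
      using 4 j frac_mem kU by (intro progress_exchange[OF x, of k j]) blast+
  qed
qed

section \<open>Monotone paths to the optimum\<close>

text \<open>Each step costs at least one unit of potential. The bound \<open>c w\<close> \<le>
  \<open>c x\<close> is carried along because optimality of the endpoint will be derived from
  it.\<close>

lemma path_to_settled:
  assumes "x \<in> vertices Q"
  shows "\<exists>m w. m \<le> potential L k x \<and> (x, w) \<in> directed_edges Q c ^^ m \<and>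
    w \<in> vertices Q \<and> c w \<le> c x \<and> UL w = {} \<and> UR w = {}"
  using assms
proof (induction "potential L k x" arbitrary: x rule: less_induct)
  case less
  show ?case
  proof (cases "UL x \<union> UR x = {}")
    case True
    then show ?thesis
      using less.prems by (intro exI[of _ 0] exI[of _ x]) auto
  next
    case False
    then obtain v where v: "(x, v) \<in> directed_edges Q c" "potential L k v < potential L k x"
      using progress less.prems by blast
    then have vx: "v \<in> vertices Q" "c v < c x"
      by (auto simp: directed_edges_def)
    obtain m w where w: "m \<le> potential L k v" "(v, w) \<in> directed_edges Q c ^^ m"
      "w \<in> vertices Q" "c w \<le> c v" "UL w = {}" "UR w = {}"
      using less.hyps[OF v(2) vx(1)] by blast
    have "(x, w) \<in> directed_edges Q c ^^ Suc m"
      using v(1) w(2) by (rule relpow_Suc_I2)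
    then show ?thesis
      using w v(2) vx(2) by (intro exI[of _ "Suc m"] exI[of _ w]) auto
  qed
qed

text \<open>Every column but \<open>k\<close> is prescribed to be full or empty, and the row sum
  determines \<open>k\<close>.\<close>

lemma settled_unique:
  assumes "x \<in> Q" "y \<in> Q" "UL x = {}" "UR x = {}" "UL y = {}" "UR y = {}"
  shows "x = y"
proof -
  have eq: "x $ 1 $ l = y $ 1 $ l" if "l \<noteq> k" for l
    using assms that by (cases "l \<in> L") (simp_all add: unfilled_def unemptied_def, metis+)
  have "(\<Sum>l\<in>UNIV - {k}. x $ 1 $ l) = (\<Sum>l\<in>UNIV - {k}. y $ 1 $ l)"
    by (intro sum.cong) (auto simp: eq)
  moreover have "(\<Sum>l\<in>UNIV. x $ 1 $ l) = (\<Sum>l\<in>UNIV. y $ 1 $ l)"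
    using assms by (simp add: mem_Q_iff)
  ultimately have "x $ 1 $ k = y $ 1 $ k"
    by (simp add: sum.remove[of UNIV k])
  with eq have "x $ 1 $ l = y $ 1 $ l" for l
    by metis
  with Q_eqI assms show ?thesis
    by blast
qed

lemma monotone_distance_le:
  assumes "x \<in> vertices Q"
  shows "monotone_distance Q c x \<le> enat (CARD('n))"
proof -
  obtain m w where w: "m \<le> potential L k x" "(x, w) \<in> directed_edges Q c ^^ m"
    "w \<in> vertices Q" "UL w = {}" "UR w = {}"
    using path_to_settled[OF assms] by blast
  \<comment> \<open>The descending path from any vertex \<open>y\<close> ends in a settled vertex,
    which by uniqueness is \<open>w\<close>; so the paths themselves certify that \<open>w\<close>
    is optimal.\<close>
  have "c w \<le> c y" if y: "y \<in> vertices Q" for y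
    using path_to_settled[OF y] settled_unique w(3-5) unfolding vertex_iff by metis
  then have "m \<in> monotone_path_lengths Q c x"
    using w by (auto simp: monotone_path_lengths_def optimal_vertex_def)
  then have "monotone_distance Q c x \<le> enat m"
    unfolding monotone_distance_def by (rule INF_lower)
  also have "\<dots> \<le> enat (CARD('n))"
    using w(1) potential_le[OF k, of x] by simp
  finally show ?thesis .
qed

end

theorem monotone_diameter_le: "monotone_diameter Q \<le> enat (CARD('n))"
  unfolding monotone_diameter_def objective_monotone_diameter_def
proof (intro SUP_least)
  fix c x
  assume c: "c \<in> {c. nondegenerate_objective Q c}" and x: "x \<in> vertices Q"
  obtain L k where Lk: "k \<notin> L" "\<And>i. i \<in> L \<Longrightarrow> c (shift i) \<le> c (shift k)"
    "\<And>j. j \<notin> L \<Longrightarrow> c (shift k) \<le> c (shift j)"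
    "sum (($) b) L < a $ 1" "a $ 1 \<le> sum (($) b) L + b $ k"
    using critical_column[of "\<lambda>j. c (shift j)"] by metis
  show "monotone_distance Q c x \<le> enat (CARD('n))"
    using c by (intro monotone_distance_le[where c = c and L = L and k = k, OF _ Lk x]) simp_all
qed

end

theorem theorem1p11:
  fixes a :: "real^2" and b :: "real^'n"
  assumes "\<And>i. 0 < a $ i"
    and "\<And>j. 0 < b $ j"
    and "a $ 1 + a $ 2 = (\<Sum>j\<in>UNIV. b $ j)"
  shows "monotone_diameter (transportation_polytope a b) \<le> enat (CARD('n)) \<and>
         monotone_diameter (transportation_polytope a b)
           \<le> enat (transportation_hirsch_bound 2 (CARD('n))) \<and>
         transportation_hirsch_bound 2 (CARD('n)) = 2 + CARD('n) - 1 \<and>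
         2 + CARD('n) - 1 = CARD('n) + 1"
proof -
  interpret two_row_transportation a b
    using assms by unfold_locales
  have hirsch: "transportation_hirsch_bound 2 (CARD('n)) = 2 + CARD('n) - 1"
    by (rule transportation_hirsch_bound_eq) (simp_all add: Suc_le_eq)
  have "enat (CARD('n)) \<le> enat (transportation_hirsch_bound 2 (CARD('n)))"
    by (simp add: hirsch)
  with monotone_diameter_le have
    "monotone_diameter Q \<le> enat (transportation_hirsch_bound 2 (CARD('n)))"
    by (rule order_trans)
  with monotone_diameter_le hirsch show ?thesis
    by simp
qed

end
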